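(* Let $n\ge1$, let $a_1,\ldots,a_{n+1}$ be nonnegative integers and let $x=(x_1,\ldots,x_n)\in\Delta_n$, with $x_{n+1}:=1-x_1-\cdots-x_n$. Let $i\in\{1,2,\ldots,n+1\}$ and let $\sigma$ be the cyclic permutation of $1,\ldots,n+1$ (i.e., the power of the cycle $1\mapsto2\mapsto\cdots\mapsto n+1\mapsto1$) which sends $n$ to $i$. Then $$ \frac{I^{(i)}_{a_1,\ldots,a_{n+1}}(x)}{I_{a_1,\ldots,a_{n+1}}}=f_{a_{\sigma(n+1)},a_{\sigma(1)},\ldots,a_{\sigma(n)}}(x_{\sigma(n+1)},x_{\sigma(1)},\ldots,x_{\sigma(n-1)}). $$
   Context: $(a)_k$ is the Pochhammer symbol: $(a)_0=1$ and $(a)_k=a(a+1)\cdots(a+k-1)$ for $k\ge1$. $\Delta_n\subset\mathbb{R}^n$ is the simplex with vertices $0$ and the standard basis vectors $e_1,\ldots,e_n$. For $x\in\Delta_n$ and $i\in\{1,\ldots,n+1\}$, $\Delta_n^{(i)}(x)$ denotes the simplex in $\mathbb{R}^n$ which has $x$ as a vertex and $n$ further vertices taken from $0,e_1,\ldots,e_n$, where $e_i$ is deleted if $i\in\{1,\ldots,n\}$ and $0$ is deleted if $i=n+1$. Define $$ I_{a_1,\ldots,a_{n+1}}:=\int_{\Delta_n}t_1^{a_1}\cdots t_n^{a_n}(1-t_1-\cdots-t_n)^{a_{n+1}}\,dt_1\cdots dt_n, $$ $$ I^{(i)}_{a_1,\ldots,a_{n+1}}(x):=\int_{\Delta_n^{(i)}(x)}t_1^{a_1}\cdots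 t_n^{a_n}(1-t_1-\cdots-t_n)^{a_{n+1}}\,dt_1\cdots dt_n. $$ For nonnegative integers $b_1,\ldots,b_{n+1}$ and $y=(y_1,\ldots,y_n)$, $$ f_{b_1,\ldots,b_{n+1}}(y_1,\ldots,y_n):=(1-y_1-\cdots-y_n)^{b_{n+1}+1}\sum_{k_1=0}^{b_1}\cdots\sum_{k_n=0}^{b_n}\frac{(b_{n+1}+1)_{k_1+\cdots+k_n}}{k_1!\cdots k_n!}\,y_1^{k_1}\cdots y_n^{k_n}. $$ *)

theory Defs
  imports "HOL-Analysis.Analysis" "HOL-Combinatorics.Cycles"
begin

text \<open>
  The space \<open>\<real>\<^sup>n\<close> is \<open>real ^ 'n\<close> with \<open>n = CARD('n)\<close>.  Since the index type \<open>'n\<close> carries no order,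
  the numbering of the coordinates by \<open>1, \<dots>, n\<close> is a bijection \<open>c\<close> from \<open>{1..CARD('n)}\<close>
  onto \<open>'n\<close>: the \<open>j\<close>-th coordinate of \<open>t\<close> is \<open>t $ c j\<close>.
\<close>

definition std_simplex :: "(real ^ 'n) set" where
  "std_simplex = convex hull (insert 0 Basis)"

text \<open>The vertex numbered \<open>n + 1\<close> is the origin.\<close>

definition vertex :: "(nat \<Rightarrow> 'n::finite) \<Rightarrow> nat \<Rightarrow> real ^ 'n" where
  "vertex c j = (if j = CARD('n) + 1 then 0 else axis (c j) 1)"

text \<open>
  If \<open>x\<close> lies in the convex hull of the remaining vertices, this is a degenerate simplex (a null set).
\<close>

definition sub_simplex :: "(nat \<Rightarrow> 'n::finite) \<Rightarrow> nat \<Rightarrow> real ^ 'n \<Rightarrow> (real ^ 'n) set" where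
  "sub_simplex c i x = convex hull (insert x (vertex c ` ({1..CARD('n) + 1} - {i})))"

text \<open>The convention \<open>t\<^sub>n\<^sub>+\<^sub>1 = 1 - t\<^sub>1 - \<dots> - t\<^sub>n\<close> is built into the coordinates.\<close>

definition coord :: "(nat \<Rightarrow> 'n::finite) \<Rightarrow> real ^ 'n \<Rightarrow> nat \<Rightarrow> real" where
  "coord c t j = (if j = CARD('n) + 1 then 1 - (\<Sum>k = 1..CARD('n). t $ c k) else t $ c j)"

definition integrand :: "(nat \<Rightarrow> 'n::finite) \<Rightarrow> (nat \<Rightarrow> nat) \<Rightarrow> real ^ 'n \<Rightarrow> real" where
  "integrand c a t = (\<Prod>j = 1..CARD('n) + 1. coord c t j ^ a j)"

definition I_full :: "(nat \<Rightarrow> 'n::finite) \<Rightarrow> (nat \<Rightarrow> nat) \<Rightarrow> real" where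
  "I_full c a = integral std_simplex (integrand c a)"

definition I_sub :: "(nat \<Rightarrow> 'n::finite) \<Rightarrow> nat \<Rightarrow> (nat \<Rightarrow> nat) \<Rightarrow> real ^ 'n \<Rightarrow> real" where
  "I_sub c i a x = integral (sub_simplex c i x) (integrand c a)"

definition f_poly :: "nat \<Rightarrow> (nat \<Rightarrow> nat) \<Rightarrow> (nat \<Rightarrow> real) \<Rightarrow> real" where
  "f_poly n b y =
     (1 - (\<Sum>j = 1..n. y j)) ^ (b (n + 1) + 1) *
     (\<Sum>k \<in> (\<Pi>\<^sub>E j\<in>{1..n}. {0..b j}).
        pochhammer (real (b (n + 1) + 1)) (\<Sum>j = 1..n. k j) / (\<Prod>j = 1..n. fact (k j)) *
        (\<Prod>j = 1..n. y j ^ k j))"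

end

theory Submission
  imports Defs
begin

text \<open>
  Write \<open>t\<^sub>1, \<dots>, t\<^sub>n\<^sub>+\<^sub>1\<close> for the barycentric coordinates of \<open>t\<close> with respect to the vertices
  \<open>v\<^sub>1, \<dots>, v\<^sub>n\<^sub>+\<^sub>1\<close> of the standard simplex \<open>\<Delta>\<close>; in these coordinates all vertices play the same role.

  The simplex \<open>\<Delta>\<^sup>(\<^sup>i\<^sup>)(x)\<close> is the image of \<open>\<Delta>\<close> under the affine map \<open>s \<mapsto> s + s\<^sub>i (x - v\<^sub>i)\<close>, which fixes the
  vertices other than \<open>v\<^sub>i\<close> and moves \<open>v\<^sub>i\<close> to \<open>x\<close>.  Its linear part is the identity plus a matrix of
  rank one, with determinant \<open>x\<^sub>i\<close>, and in barycentric coordinates the map reads \<open>t\<^sub>i = s\<^sub>i x\<^sub>i\<close> and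
  \<open>t\<^sub>j = s\<^sub>j + s\<^sub>i x\<^sub>j\<close> for \<open>j \<noteq> i\<close>.  Thus \<open>integral_sub_simplex\<close> turns the integral over \<open>\<Delta>\<^sup>(\<^sup>i\<^sup>)(x)\<close>
  into \<open>x\<^sub>i\<close> raised to the power \<open>a\<^sub>i + 1\<close>, times the integral over \<open>\<Delta>\<close> of a power of \<open>s\<^sub>i\<close> and of
  powers of the \<open>s\<^sub>j + s\<^sub>i x\<^sub>j\<close>.  Expanding these by the binomial theorem leaves integrals of monomials
  in the \<open>s\<^sub>j\<close>, all of the same total degree.  Dirichlet's formula \<open>dirichlet_integral\<close>, by which such an
  integral is \<open>\<Prod>\<^sub>j a\<^sub>j! / (n + \<Sum>\<^sub>j a\<^sub>j)!\<close>, evaluates them, and after division the factorials that remain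
  are exactly the coefficients of the polynomial \<open>f\<close> (\<open>I_sub_div_I_full\<close>).  A degenerate
  \<open>\<Delta>\<^sup>(\<^sup>i\<^sup>)(x)\<close> is the case of determinant \<open>0\<close>, where both sides vanish.  The permutation \<open>\<sigma>\<close> does
  no more than enumerate the indices different from \<open>i\<close>.

  Dirichlet's formula comes from the same change of variables, without iterated integrals.  Let \<open>x\<close> be the
  point at parameter \<open>h\<close> on the edge from \<open>v\<^sub>i\<close> to \<open>v\<^sub>j\<close>.  Then \<open>\<Delta>\<close> is the union of \<open>\<Delta>\<^sup>(\<^sup>i\<^sup>)(x)\<close> and
  \<open>\<Delta>\<^sup>(\<^sup>j\<^sup>)(x)\<close>.  The integral over the first part is a polynomial in \<open>h\<close>.  If the exponent of \<open>t\<^sub>j\<close> is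
  positive, the integral over the second part is \<open>O(h\<^sup>2)\<close>, because its volume is \<open>O(h)\<close> and \<open>t\<^sub>j \<le> h\<close> on
  it.  Hence the polynomial has derivative \<open>0\<close> at \<open>h = 0\<close>, which says that raising \<open>a\<^sub>i\<close> by one and
  raising \<open>a\<^sub>j\<close> by one multiply the integral by factors in the ratio \<open>a\<^sub>i + 1\<close> to \<open>a\<^sub>j + 1\<close>
  (\<open>I_full_exchange\<close>).  Together with \<open>\<Sum>\<^sub>j t\<^sub>j = 1\<close> this determines all the integrals from the volume of \<open>\<Delta>\<close>.
\<close>

section \<open>Rank-one changes of variables in Euclidean spaces\<close>

text \<open>
  For \<open>v = e\<^sub>k\<close> the matrix \<open>1 + u v\<^sup>T\<close> is the identity with one column replaced, and Cramer's rule gives its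
  determinant.  The general case is reduced to this one by conjugation with a matrix \<open>B\<close> whose \<open>k\<close>-th row
  is \<open>v\<close>: since \<open>v\<^sup>T = e\<^sub>k\<^sup>T B\<close>, one has \<open>B (1 + u v\<^sup>T) = (1 + (B u) e\<^sub>k\<^sup>T) B\<close>.
\<close>
lemma det_rank_one_update:
  fixes u v :: "'a::field ^ 'n"
  shows "det (\<chi> i j. (if i = j then 1 else 0) + u $ i * v $ j) = 1 + (\<Sum>i\<in>UNIV. v $ i * u $ i)"
    (is "det ?A = _")
proof (cases "v = 0")
  case True
  then have "?A = mat 1"
    by (simp add: mat_def vec_eq_iff)
  with True show ?thesis
    by simp
next
  case False
  then obtain k where k: "v $ k \<noteq> 0"
    by (auto simp: vec_eq_iff)
  \<comment> \<open>the identity with its \<open>k\<close>-th row replaced by \<open>v\<close>; its determinant is \<open>v $ k\<close>, hence nonzero\<close>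
  define B :: "'a^'n^'n" where "B = (\<chi> i j. if i = k then v $ j else if i = j then 1 else 0)"
  define w where "w = B *v u"
  define C :: "'a^'n^'n"
    where "C = (\<chi> i j. (if i = j then 1 else 0) + w $ i * (if j = k then 1 else 0))"
  have "transpose B = (\<chi> i j. if j = k then (mat 1 *v v) $ i else mat 1 $ i $ j)"
    unfolding matrix_vector_mul_lid by (auto simp: B_def transpose_def mat_def vec_eq_iff)
  then have "det (transpose B) = v $ k"
    using cramer_lemma[of k "mat 1" v] by simp
  then have detB: "det B = v $ k"
    by simp
  have "C = (\<chi> i j. if j = k then (mat 1 *v (w + axis k 1)) $ i else mat 1 $ i $ j)"
    unfolding matrix_vector_mul_lid by (auto simp: C_def mat_def vec_eq_iff axis_def)
  then have "det C = (w + axis k 1) $ k"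
    using cramer_lemma[of k "mat 1" "w + axis k 1"] by simp
  also have "\<dots> = 1 + (\<Sum>i\<in>UNIV. v $ i * u $ i)"
    by (simp add: w_def B_def matrix_vector_mult_def axis_def)
  finally have detC: "det C = 1 + (\<Sum>i\<in>UNIV. v $ i * u $ i)" .
  have "(B ** ?A) $ i $ j = (C ** B) $ i $ j" for i j
  proof -
    have "(B ** ?A) $ i $ j = (\<Sum>l\<in>UNIV. B $ i $ l * ((if l = j then 1 else 0) + u $ l * v $ j))"
      by (simp add: matrix_matrix_mult_def)
    also have "\<dots> = (\<Sum>l\<in>UNIV. (if l = j then B $ i $ l else 0) + B $ i $ l * u $ l * v $ j)"
      by (intro sum.cong refl) (simp add: algebra_simps)
    also have "\<dots> = B $ i $ j + w $ i * v $ j"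
      by (simp add: sum.distrib w_def matrix_vector_mult_def sum_distrib_right)
    also have "\<dots> = B $ i $ j + w $ i * B $ k $ j"
      by (simp add: B_def)
    also have "\<dots> = (\<Sum>l\<in>UNIV. (if i = l then B $ l $ j else 0) + (if l = k then w $ i * B $ l $ j else 0))"
      by (simp add: sum.distrib)
    also have "\<dots> = (\<Sum>l\<in>UNIV. C $ i $ l * B $ l $ j)"
      by (intro sum.cong refl) (simp add: C_def algebra_simps)
    also have "\<dots> = (C ** B) $ i $ j"
      by (simp add: matrix_matrix_mult_def)
    finally show ?thesis .
  qed
  then have "B ** ?A = C ** B"
    by (simp add: vec_eq_iff)
  then have "det B * det ?A = det C * det B"
    by (simp only: det_mul[symmetric])
  with detB detC k show ?thesis
    by simp
qed

lemma absolutely_integrable_continuous_compact: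
  fixes f :: "'a::euclidean_space \<Rightarrow> 'b::euclidean_space"
  assumes "compact S" "continuous_on S f"
  shows "set_integrable lborel S f" "f absolutely_integrable_on S" "f integrable_on S"
proof -
  show *: "set_integrable lborel S f"
    using borel_integrable_compact[OF assms] by (simp add: set_integrable_def)
  then show "f absolutely_integrable_on S"
    by (simp add: set_integrable_def integrable_completion)
  from * show "f integrable_on S"
    by (rule set_borel_integral_eq_integral)
qed

text \<open>
  Both translations and the choice of coordinates with respect to an orthonormal basis enter the change of
  variables through this lemma.
\<close>
lemma integral_image_measure_preserving:
  fixes h :: "'a::euclidean_space \<Rightarrow> 'b::euclidean_space" and f :: "'b \<Rightarrow> real"
  assumes h: "continuous_on UNIV h" "inj h" "distr lborel borel h = lborel"
    and S: "compact S" and f: "continuous_on UNIV f"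
  shows "integral (h ` S) f = integral S (\<lambda>x. f (h x))"
proof -
  have fh: "continuous_on S (\<lambda>x. f (h x))"
    using continuous_on_compose2[OF f h(1)] continuous_on_subset by auto
  have hS: "compact (h ` S)"
    using S h(1) compact_continuous_image continuous_on_subset by blast
  have [measurable]: "h \<in> borel_measurable borel" "f \<in> borel_measurable borel"
      "h ` S \<in> sets borel"
    using h(1) f hS by (auto intro: borel_measurable_continuous_onI borel_compact)
  have "integral (h ` S) f = (LINT y : h ` S | lborel. f y)"
    by (rule set_borel_integral_eq_integral(2)[symmetric, OF absolutely_integrable_continuous_compact(1)])
       (rule hS, rule continuous_on_subset[OF f subset_UNIV])
  also have "\<dots> = (LINT y | distr lborel borel h. indicator (h ` S) y *\<^sub>R f y)"
    by (simp add: set_lebesgue_integral_def h(3))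
  also have "\<dots> = (LINT x | lborel. indicator (h ` S) (h x) *\<^sub>R f (h x))"
    by (subst integral_distr) auto
  also have "\<dots> = (LINT x : S | lborel. f (h x))"
    by (simp add: set_lebesgue_integral_def indicator_image[OF h(2)])
  also have "\<dots> = integral S (\<lambda>x. f (h x))"
    using set_borel_integral_eq_integral(2)[OF absolutely_integrable_continuous_compact(1)[OF S fh]] .
  finally show ?thesis .
qed

lemma integral_rank_one_update_cart:
  fixes u v :: "real ^ 'm::{finite,wellorder}" and f :: "real ^ 'm::_ \<Rightarrow> real"
  assumes S: "compact S" and f: "continuous_on UNIV f"
  shows "integral ((\<lambda>s. s + (v \<bullet> s) *\<^sub>R u) ` S) f =
         \<bar>1 + v \<bullet> u\<bar> * integral S (\<lambda>s. f (s + (v \<bullet> s) *\<^sub>R u))"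
proof -
  define g where "g = (\<lambda>s. s + (v \<bullet> s) *\<^sub>R u)"
  \<comment> \<open>the change of variables formula for linear maps speaks of vector-valued functions\<close>
  define F :: "real^'m::_ \<Rightarrow> real^1" where "F = (\<lambda>s. vec (f s))"
  have lin: "linear g"
    unfolding g_def by (intro linearI) (auto simp: algebra_simps inner_add_right)
  have contF: "continuous_on UNIV F"
    unfolding F_def vec_def by (intro continuous_intros f)
  have contg: "continuous_on UNIV g"
    using lin by (simp add: linear_continuous_on linear_linear)
  have "matrix g = (\<chi> i j. (if i = j then 1 else 0) + u $ i * v $ j)"
    by (auto simp: matrix_def g_def axis_def inner_vec_def vec_eq_iff if_distrib cong: if_cong)
  then have det: "det (matrix g) = 1 + v \<bullet> u"
    by (simp add: det_rank_one_update inner_vec_def)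
  have int: "F absolutely_integrable_on g ` S"
    using S contF contg
    by (intro absolutely_integrable_continuous_compact) (auto intro: compact_continuous_image continuous_on_subset)
  have int2: "(F \<circ> g) integrable_on S"
    using continuous_on_compose[OF continuous_on_subset[OF contg] continuous_on_subset[OF contF]] S
    by (intro absolutely_integrable_continuous_compact) auto
  have "integral (g ` S) F $ 1 = \<bar>1 + v \<bullet> u\<bar> * integral S (F \<circ> g) $ 1"
    using integral_change_of_variables_linear[OF lin disjI1[OF int]] by (simp add: det)
  moreover have "integral (g ` S) F $ 1 = integral (g ` S) f"
    using integral_component_eq_cart[of F "g ` S" 1] int
    by (simp add: F_def set_lebesgue_integral_eq_integral)
  moreover have "integral S (F \<circ> g) $ 1 = integral S (\<lambda>s. f (g s))"
    using integral_component_eq_cart[OF int2, of 1] by (simp add: F_def)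
  ultimately show ?thesis
    by (simp add: g_def)
qed

text \<open>
  The change of variables formula for linear maps is stated for coordinates with a well-ordered index type.
  This copy of an initial segment of the naturals is such a type with one index for each dimension of \<open>'a\<close>;
  coordinates indexed by it carry the formula over to every Euclidean space, in particular to \<open>real ^ 'n\<close> where \<open>'n\<close> has no order.
\<close>
typedef (overloaded) 'a dim_index = "{..<DIM('a::euclidean_space)}"
  morphisms index_nat nat_index
  by (rule exI[of _ 0]) simp

instance dim_index :: (euclidean_space) finite
proof
  have "(UNIV :: 'a dim_index set) = nat_index ` {..<DIM('a)}"
    by (metis UNIV_eq_I index_nat_inverse index_nat image_eqI)
  then show "finite (UNIV :: 'a dim_index set)"
    by (metis finite_imageI finite_lessThan)
qed

instantiation dim_index :: (euclidean_space) wellorder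
begin

definition "i \<le> j \<longleftrightarrow> index_nat i \<le> index_nat j"
definition "i < j \<longleftrightarrow> index_nat i < index_nat j"

instance
proof
  fix P :: "'a dim_index \<Rightarrow> bool" and i :: "'a dim_index"
  assume step: "\<And>i. (\<And>j. j < i \<Longrightarrow> P j) \<Longrightarrow> P i"
  show "P i"
    by (induction "index_nat i" arbitrary: i rule: less_induct)
       (use step in \<open>auto simp: less_dim_index_def\<close>)
qed (auto simp: less_eq_dim_index_def less_dim_index_def index_nat_inject)

end

lemma bij_betw_dim_index_Basis:
  "\<exists>e :: 'a::euclidean_space dim_index \<Rightarrow> 'a. bij_betw e UNIV Basis"
proof -
  have "bij_betw index_nat (UNIV :: 'a dim_index set) {..<DIM('a)}"
    using type_definition.Rep_range[OF type_definition_dim_index]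
    by (auto simp: bij_betw_def inj_def index_nat_inject)
  moreover obtain e :: "nat \<Rightarrow> 'a" where "bij_betw e {..<DIM('a)} Basis"
    using ex_bij_betw_nat_finite[of "Basis :: 'a set"] by (auto simp: atLeast0LessThan)
  ultimately show ?thesis
    by (blast intro: bij_betw_trans)
qed

text \<open>
  Passing to coordinates with respect to an enumerated orthonormal basis maps boxes to boxes with the same
  side lengths, hence preserves Lebesgue measure.
\<close>
lemma distr_lborel_relabel_basis:
  fixes e :: "'i::finite \<Rightarrow> 'a::euclidean_space" and R :: "real ^ 'i \<Rightarrow> 'a"
  assumes e: "bij_betw e UNIV Basis"
    and R_def: "R = (\<lambda>y. \<Sum>i\<in>UNIV. (y $ i) *\<^sub>R e i)"
  shows "R y \<bullet> R z = y \<bullet> z" "inj R" "surj R" "linear R" "distr lborel borel R = lborel"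
proof -
  have eB: "e i \<in> Basis" for i
    using e by (auto simp: bij_betw_def)
  have e_inner: "e i \<bullet> e j = (if i = j then 1 else 0)" for i j
    using e by (auto simp: inner_Basis eB bij_betw_def inj_on_def)
  have comp: "R y \<bullet> e i = y $ i" for y i
    by (simp add: R_def inner_sum_left e_inner if_distrib cong: if_cong)
  show inner: "R y \<bullet> R z = y \<bullet> z" for y z
    by (subst (2) R_def) (simp add: inner_sum_right comp inner_vec_def mult.commute)
  show lin: "linear R"
    unfolding R_def by (intro linearI) (auto simp: algebra_simps sum.distrib scaleR_sum_right)
  show "inj R"
    by (metis comp injI vec_eq_iff)
  have "R (\<chi> i. x \<bullet> e i) = x" for x
  proof (rule euclidean_eqI)
    fix b :: 'a assume "b \<in> Basis"
    then obtain i where "b = e i"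
      using e by (auto simp: bij_betw_def)
    then show "R (\<chi> i. x \<bullet> e i) \<bullet> b = x \<bullet> b"
      by (simp add: comp)
  qed
  then show "surj R"
    by (rule surjI)
  have [measurable]: "R \<in> borel_measurable borel"
    using lin by (intro borel_measurable_continuous_onI) (simp add: linear_continuous_on linear_linear)
  show "distr lborel borel R = lborel"
  proof (rule lborel_eqI[symmetric])
    fix l u :: 'a
    assume le: "\<And>b. b \<in> Basis \<Longrightarrow> l \<bullet> b \<le> u \<bullet> b"
    have ax: "bij_betw (\<lambda>i. axis i (1::real)) (UNIV :: 'i set) Basis"
      by (auto simp: bij_betw_def inj_def axis_eq_axis Basis_vec_def)
    have "R -` box l u = box (\<chi> i. l \<bullet> e i) (\<chi> i. u \<bullet> e i)"
    proof -
      have "R y \<in> box l u \<longleftrightarrow> (\<forall>b\<in>e ` UNIV. l \<bullet> b < R y \<bullet> b \<and> R y \<bullet> b < u \<bullet> b)" for y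
        using e by (simp add: box_def bij_betw_def)
      then show ?thesis
        by (auto simp: comp mem_box_cart)
    qed
    then have "emeasure (distr lborel borel R) (box l u) =
        emeasure lborel (box (\<chi> i. l \<bullet> e i) (\<chi> i. u \<bullet> e i))"
      by (simp add: emeasure_distr)
    also have "\<dots> = (\<Prod>b\<in>Basis. ((\<chi> i. u \<bullet> e i) - (\<chi> i. l \<bullet> e i)) \<bullet> b)"
      by (rule emeasure_lborel_box) (auto simp: Basis_vec_def inner_axis le eB)
    also have "(\<Prod>b\<in>Basis. ((\<chi> i. u \<bullet> e i) - (\<chi> i. l \<bullet> e i)) \<bullet> b) = (\<Prod>i\<in>UNIV. (u - l) \<bullet> e i)"
      by (subst prod.reindex_bij_betw[OF ax, symmetric]) (simp add: inner_axis inner_diff_left)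
    also have "\<dots> = (\<Prod>b\<in>Basis. (u - l) \<bullet> b)"
      by (rule prod.reindex_bij_betw[OF e])
    finally show "emeasure (distr lborel borel R) (box l u) = (\<Prod>b\<in>Basis. (u - l) \<bullet> b)" .
  qed simp
qed

text \<open>
  Rank-one updates are the right class of maps here because their determinant is expressed by the inner product
  alone, and so does not depend on the coordinates in which it is computed.
\<close>
lemma integral_rank_one_update:
  fixes u v w :: "'a::euclidean_space" and f :: "'a \<Rightarrow> real"
  assumes S: "compact S" and f: "continuous_on UNIV f"
  shows "integral ((\<lambda>s. w + (s + (v \<bullet> s) *\<^sub>R u)) ` S) f =
         \<bar>1 + v \<bullet> u\<bar> * integral S (\<lambda>s. f (w + (s + (v \<bullet> s) *\<^sub>R u)))"
proof -
  obtain e :: "'a dim_index \<Rightarrow> 'a" where e: "bij_betw e UNIV Basis"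
    using bij_betw_dim_index_Basis by blast
  define R where "R = (\<lambda>y :: real ^ 'a dim_index. \<Sum>i\<in>UNIV. (y $ i) *\<^sub>R e i)"
  note R = distr_lborel_relabel_basis[OF e R_def]
  have contR: "continuous_on A R" for A
    using R(4) by (simp add: linear_continuous_on linear_linear)
  obtain u' v' where uv: "u = R u'" "v = R v'"
    using R(3) by (metis surjD)
  define S' where "S' = R -` S"
  have SS': "S = R ` S'"
    using R(3) by (simp add: S'_def surj_image_vimage_eq)
  have "compact S'"
  proof -
    obtain g where g: "linear g" "g \<circ> R = id"
      using linear_injective_left_inverse[OF R(4,2)] by blast
    have "g ` S = (g \<circ> R) ` S'"
      by (simp only: SS' image_comp)
    then have "S' = g ` S"
      by (simp add: g(2))
    with g(1) S show ?thesis
      by (simp add: compact_continuous_image linear_continuous_on linear_linear)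
  qed
  define g g' where "g = (\<lambda>s. s + (v \<bullet> s) *\<^sub>R u)" and "g' = (\<lambda>s. s + (v' \<bullet> s) *\<^sub>R u')"
  have gR: "g (R y) = R (g' y)" for y
    using R(4) by (simp add: g_def g'_def uv R(1) linear_add linear_scale)
  have contg: "continuous_on A g" and contg': "continuous_on A' g'" for A A'
    unfolding g_def g'_def by (intro continuous_intros)+
  have fw: "continuous_on UNIV (\<lambda>s. f (w + s))"
    by (intro continuous_on_compose2[OF f] continuous_intros) auto
  have fwR: "continuous_on UNIV (\<lambda>s. f (w + R s))"
    by (rule continuous_on_compose2[OF fw contR]) auto
  have fwg: "continuous_on UNIV (\<lambda>s. f (w + g s))"
    by (rule continuous_on_compose2[OF fw contg]) auto
  have "integral ((\<lambda>s. w + g s) ` S) f = integral ((+) w ` g ` S) f"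
    by (simp add: image_image)
  also have "\<dots> = integral (g ` S) (\<lambda>s. f (w + s))"
    by (rule integral_image_measure_preserving)
       (auto intro!: continuous_intros compact_continuous_image contg f S simp: lborel_distr_plus)
  also have "g ` S = R ` g' ` S'"
    by (simp add: SS' image_image gR)
  also have "integral (R ` g' ` S') (\<lambda>s. f (w + s)) = integral (g' ` S') (\<lambda>y. f (w + R y))"
    by (rule integral_image_measure_preserving)
       (auto intro!: contR compact_continuous_image contg' fw \<open>compact S'\<close> simp: R)
  also have "\<dots> = \<bar>1 + v' \<bullet> u'\<bar> * integral S' (\<lambda>y. f (w + R (g' y)))"
    unfolding g'_def by (rule integral_rank_one_update_cart[OF \<open>compact S'\<close> fwR])
  also have "integral S' (\<lambda>y. f (w + R (g' y))) = integral S' (\<lambda>y. f (w + g (R y)))"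
    by (simp add: gR)
  also have "\<dots> = integral (R ` S') (\<lambda>s. f (w + g s))"
    by (rule integral_image_measure_preserving[symmetric]) (auto intro: contR fwg \<open>compact S'\<close> simp: R)
  finally show ?thesis
    by (simp add: SS'[symmetric] uv R(1) g_def)
qed

section \<open>A derivative test\<close>

text \<open>
  The bound forces the difference quotients on the right of zero to vanish in the limit, and that limit is the derivative.
\<close>
lemma derivative_zero_of_quadratic_bound:
  fixes f :: "real \<Rightarrow> real"
  assumes f: "(f has_real_derivative D) (at 0)"
    and bound: "\<And>h. 0 < h \<Longrightarrow> h < 1 \<Longrightarrow> \<bar>f h - f 0\<bar> \<le> C * h\<^sup>2"
  shows "D = 0"
proof -
  have "((\<lambda>h. (f h - f 0) / h) \<longlongrightarrow> D) (at 0)"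
    using f by (simp add: DERIV_def)
  then have "((\<lambda>h. (f h - f 0) / h) \<longlongrightarrow> D) (at_right 0)"
    by (rule filterlim_mono) (simp_all add: at_le)
  moreover have "((\<lambda>h. (f h - f 0) / h) \<longlongrightarrow> 0) (at_right 0)"
  proof (rule Lim_null_comparison)
    have "\<forall>\<^sub>F h in at_right (0::real). 0 < h \<and> h < 1"
      using eventually_at_right_real[of 0 1] by (auto elim: eventually_mono)
    then show "\<forall>\<^sub>F h in at_right 0. norm ((f h - f 0) / h) \<le> C * h"
    proof eventually_elim
      case (elim h)
      then show ?case
        using bound[of h] by (simp add: abs_divide divide_le_eq power2_eq_square mult.assoc)
    qed
    show "((\<lambda>h. C * h) \<longlongrightarrow> 0) (at_right 0)"
      by (auto intro!: tendsto_eq_intros)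
  qed
  ultimately show ?thesis
    using tendsto_unique trivial_limit_at_right_real by blast
qed

section \<open>Barycentric coordinates on the standard simplex\<close>

text \<open>
  With respect to such a numbering the vertices and the barycentric coordinates are indexed by
  \<open>1, \<dots>, n + 1\<close>, without a distinction between the coordinates of the vector and the complementary one.
\<close>
locale coordinate_numbering =
  fixes c :: "nat \<Rightarrow> 'n::finite"
  assumes bij_c: "bij_betw c {1..CARD('n)} UNIV"
begin

abbreviation bary :: "real ^ 'n \<Rightarrow> nat \<Rightarrow> real" where
  "bary \<equiv> coord c"

lemma sum_over_numbering: "(\<Sum>k = 1..CARD('n). f (c k)) = (\<Sum>i\<in>UNIV. f i)"
  by (rule sum.reindex_bij_betw[OF bij_c])

lemma sum_bary: "(\<Sum>j\<in>{1..CARD('n) + 1}. bary t j) = 1"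
  by (simp add: coord_def)

lemma prod_remove_index:
  "i \<in> {1..CARD('n) + 1} \<Longrightarrow> prod f {1..CARD('n) + 1} = f i * prod f ({1..CARD('n) + 1} - {i})"
  by (rule prod.remove) auto

lemma bary_add_scaleR_diff:
  "bary (s + r *\<^sub>R (x - y)) j = bary s j + r * (bary x j - bary y j)"
  by (simp add: coord_def sum.distrib sum_subtractf sum_distrib_left algebra_simps)

lemma bary_vertex:
  assumes "i \<in> {1..CARD('n) + 1}" "j \<in> {1..CARD('n) + 1}"
  shows "bary (vertex c i) j = (if i = j then 1 else 0)"
proof -
  have eq: "c k = c l \<longleftrightarrow> k = l" if "k \<in> {1..CARD('n)}" "l \<in> {1..CARD('n)}" for k l
    by (rule inj_on_eq_iff[OF bij_betw_imp_inj_on[OF bij_c] that])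
  show ?thesis
  proof (cases "i = CARD('n) + 1")
    case True
    with assms show ?thesis
      by (auto simp: coord_def vertex_def)
  next
    case False
    then have i: "i \<in> {1..CARD('n)}"
      using assms by auto
    show ?thesis
    proof (cases "j = CARD('n) + 1")
      case True
      have "(\<Sum>k = 1..CARD('n). vertex c i $ c k) = (\<Sum>k\<in>UNIV. axis (c i) 1 $ k)"
        using False by (subst sum_over_numbering[symmetric]) (simp add: vertex_def)
      also have "\<dots> = (1::real)"
        by (simp add: axis_def)
      finally show ?thesis
        using True False by (simp add: coord_def)
    next
      case False
      then have "j \<in> {1..CARD('n)}"
        using assms by auto
      with i show ?thesis
        by (auto simp: coord_def vertex_def axis_def eq)
    qed
  qed
qed

lemma range_vertex: "vertex c ` {1..CARD('n) + 1} = insert 0 Basis"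
proof -
  have "vertex c ` {1..CARD('n) + 1} = insert 0 ((\<lambda>k. axis (c k) 1) ` {1..CARD('n)})"
    by (auto simp: vertex_def image_iff)
  also have "(\<lambda>k. axis (c k) (1::real)) ` {1..CARD('n)} = (\<lambda>i. axis i 1) ` (c ` {1..CARD('n)})"
    by (simp add: image_image)
  also have "\<dots> = Basis"
    using bij_c by (auto simp: bij_betw_def Basis_vec_def)
  finally show ?thesis .
qed

lemma std_simplex_eq_hull: "std_simplex = convex hull (vertex c ` {1..CARD('n) + 1})"
  by (simp only: std_simplex_def range_vertex)

lemma mem_std_simplex_iff: "t \<in> std_simplex \<longleftrightarrow> (\<forall>j\<in>{1..CARD('n) + 1}. 0 \<le> bary t j)"
proof -
  have "t \<in> std_simplex \<longleftrightarrow> (\<forall>i. 0 \<le> t $ i) \<and> (\<Sum>i\<in>UNIV. t $ i) \<le> 1"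
  proof -
    have ax: "bij_betw (\<lambda>i. axis i (1::real)) (UNIV :: 'n set) Basis"
      by (auto simp: bij_betw_def inj_def axis_eq_axis Basis_vec_def)
    have "(\<Sum>b\<in>Basis. t \<bullet> b) = (\<Sum>i\<in>UNIV. t $ i)"
      by (subst sum.reindex_bij_betw[OF ax, symmetric]) (simp add: inner_axis)
    moreover have "(\<forall>b\<in>Basis. 0 \<le> t \<bullet> b) \<longleftrightarrow> (\<forall>i. 0 \<le> t $ i)"
      by (auto simp: Basis_vec_def inner_axis)
    ultimately show ?thesis
      by (simp add: std_simplex_def std_simplex)
  qed
  also have "(\<forall>i. 0 \<le> t $ i) \<longleftrightarrow> (\<forall>k\<in>{1..CARD('n)}. 0 \<le> t $ c k)"
    using bij_c by (metis UNIV_I bij_betw_def imageE)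
  also have "(\<Sum>i\<in>UNIV. t $ i) = (\<Sum>k = 1..CARD('n). t $ c k)"
    by (rule sum_over_numbering[symmetric])
  finally show ?thesis
    by (auto simp: coord_def atLeastAtMostSuc_conv)
qed

lemma bary_le_1:
  assumes "t \<in> std_simplex" "j \<in> {1..CARD('n) + 1}"
  shows "bary t j \<le> 1"
  using member_le_sum[of j "{1..CARD('n) + 1}" "bary t"] assms sum_bary[of t]
  by (auto simp: mem_std_simplex_iff)

lemma compact_std_simplex: "compact (std_simplex :: (real ^ 'n) set)"
  unfolding std_simplex_def by (intro finite_imp_compact_convex_hull) simp

lemma continuous_on_bary [continuous_intros]:
  "continuous_on S f \<Longrightarrow> continuous_on S (\<lambda>x. bary (f x) j)"
  unfolding coord_def by (cases "j = CARD('n) + 1") (auto intro!: continuous_intros)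

lemma continuous_on_integrand [continuous_intros]:
  "continuous_on S f \<Longrightarrow> continuous_on S (\<lambda>x. integrand c a (f x))"
  unfolding integrand_def by (intro continuous_intros)

lemma integrable_std_simplex:
  fixes f :: "real ^ 'n \<Rightarrow> real"
  shows "continuous_on UNIV f \<Longrightarrow> f integrable_on std_simplex"
  by (intro absolutely_integrable_continuous_compact(3) compact_std_simplex)
     (rule continuous_on_subset, auto)

section \<open>Moving one vertex of the simplex\<close>

text \<open>
  The affine map that sends vertex \<open>i\<close> to \<open>x\<close> and fixes all the others.
\<close>
definition move_vertex :: "nat \<Rightarrow> real ^ 'n \<Rightarrow> real ^ 'n \<Rightarrow> real ^ 'n" where
  "move_vertex i x s = s + bary s i *\<^sub>R (x - vertex c i)"

lemma bary_move_vertex: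
  assumes "i \<in> {1..CARD('n) + 1}" "j \<in> {1..CARD('n) + 1}"
  shows "bary (move_vertex i x s) j =
         (if j = i then bary s i * bary x i else bary s j + bary s i * bary x j)"
  unfolding move_vertex_def bary_add_scaleR_diff
  using assms by (auto simp: bary_vertex algebra_simps)

lemma move_vertex_vertex:
  assumes "i \<in> {1..CARD('n) + 1}" "j \<in> {1..CARD('n) + 1}"
  shows "move_vertex i x (vertex c j) = (if j = i then x else vertex c j)"
  using assms by (simp add: move_vertex_def bary_vertex)

lemma continuous_on_move_vertex [continuous_intros]:
  "continuous_on S f \<Longrightarrow> continuous_on S (\<lambda>s. move_vertex i x (f s))"
  unfolding move_vertex_def by (intro continuous_intros)

text \<open>
  Here \<open>v\<close> is the gradient of the \<open>i\<close>-th barycentric coordinate.  The second property gives the determinant: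
  \<open>1 + v \<bullet> (x - vertex c i) = bary x i\<close>, since vertex \<open>i\<close> has \<open>i\<close>-th coordinate \<open>1\<close>.
\<close>
lemma move_vertex_rank_one:
  obtains v where
    "move_vertex i x = (\<lambda>s. bary 0 i *\<^sub>R (x - vertex c i) + (s + (v \<bullet> s) *\<^sub>R (x - vertex c i)))"
    "\<And>y z. v \<bullet> (y - z) = bary y i - bary z i"
proof
  define v :: "real ^ 'n" where "v = (if i = CARD('n) + 1 then - (\<chi> k. 1) else axis (c i) 1)"
  have v: "bary s i = bary 0 i + v \<bullet> s" for s
  proof (cases "i = CARD('n) + 1")
    case True
    then show ?thesis
      using sum_over_numbering[of "($) s"] by (simp add: v_def coord_def inner_vec_def sum_negf)
  next
    case False
    then show ?thesis
      by (simp add: v_def coord_def inner_axis')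
  qed
  show "v \<bullet> (y - z) = bary y i - bary z i" for y z
    by (simp add: v[of y] v[of z] inner_diff_right)
  show "move_vertex i x = (\<lambda>s. bary 0 i *\<^sub>R (x - vertex c i) + (s + (v \<bullet> s) *\<^sub>R (x - vertex c i)))"
  proof
    fix s
    have "bary s i *\<^sub>R (x - vertex c i) =
        bary 0 i *\<^sub>R (x - vertex c i) + (v \<bullet> s) *\<^sub>R (x - vertex c i)"
      by (simp only: v[of s] scaleR_add_left)
    then show "move_vertex i x s = bary 0 i *\<^sub>R (x - vertex c i) + (s + (v \<bullet> s) *\<^sub>R (x - vertex c i))"
      by (simp add: move_vertex_def)
  qed
qed

lemma move_vertex_image_std_simplex:
  assumes "i \<in> {1..CARD('n) + 1}"
  shows "move_vertex i x ` std_simplex = sub_simplex c i x"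
proof -
  obtain v where v: "move_vertex i x =
      (\<lambda>s. bary 0 i *\<^sub>R (x - vertex c i) + (s + (v \<bullet> s) *\<^sub>R (x - vertex c i)))"
    using move_vertex_rank_one by blast
  define L where "L = (\<lambda>s. s + (v \<bullet> s) *\<^sub>R (x - vertex c i))"
  have L: "linear L"
    unfolding L_def by (intro linearI) (auto simp: algebra_simps inner_add_right)
  have im: "move_vertex i x ` A = (+) (bary 0 i *\<^sub>R (x - vertex c i)) ` L ` A" for A
    by (simp add: v L_def image_image)
  have "move_vertex i x ` std_simplex = convex hull (move_vertex i x ` vertex c ` {1..CARD('n) + 1})"
    unfolding std_simplex_eq_hull im by (simp only: convex_hull_linear_image[OF L] convex_hull_translation)
  also have "move_vertex i x ` vertex c ` {1..CARD('n) + 1} =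
      insert x (vertex c ` ({1..CARD('n) + 1} - {i}))"
    using assms by (auto simp: image_image move_vertex_vertex)
  finally show ?thesis
    by (simp add: sub_simplex_def)
qed

lemma integral_sub_simplex:
  assumes i: "i \<in> {1..CARD('n) + 1}" and f: "continuous_on UNIV f"
  shows "integral (sub_simplex c i x) f =
         \<bar>bary x i\<bar> * integral std_simplex (\<lambda>s. f (move_vertex i x s))"
proof -
  obtain v where v: "move_vertex i x =
      (\<lambda>s. bary 0 i *\<^sub>R (x - vertex c i) + (s + (v \<bullet> s) *\<^sub>R (x - vertex c i)))"
    and d: "\<And>y z. v \<bullet> (y - z) = bary y i - bary z i"
    using move_vertex_rank_one by blast
  have "1 + v \<bullet> (x - vertex c i) = bary x i"
    using i by (simp add: d bary_vertex)
  then show ?thesis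
    using integral_rank_one_update[OF compact_std_simplex f,
        of "bary 0 i *\<^sub>R (x - vertex c i)" v "x - vertex c i"]
    by (simp add: move_vertex_image_std_simplex[OF i, symmetric] v)
qed

section \<open>Dirichlet's integral formula\<close>

lemma integrand_remove:
  assumes "i \<in> {1..CARD('n) + 1}"
  shows "integrand c a t = bary t i ^ a i * (\<Prod>j\<in>{1..CARD('n) + 1} - {i}. bary t j ^ a j)"
  unfolding integrand_def by (rule prod_remove_index[OF assms])

lemma integrand_upd_Suc:
  assumes "i \<in> {1..CARD('n) + 1}"
  shows "integrand c (a(i := Suc (a i))) t = bary t i * integrand c a t"
proof -
  have "(\<Prod>j\<in>{1..CARD('n) + 1} - {i}. bary t j ^ (a(i := Suc (a i))) j) =
      (\<Prod>j\<in>{1..CARD('n) + 1} - {i}. bary t j ^ a j)"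
    by (rule prod.cong) auto
  then show ?thesis
    by (simp only: integrand_remove[OF assms]) (simp add: mult.assoc)
qed

lemma integrand_nonneg: "t \<in> std_simplex \<Longrightarrow> 0 \<le> integrand c a t"
  unfolding integrand_def by (intro prod_nonneg) (auto simp: mem_std_simplex_iff)

lemma integrand_le_bary:
  assumes t: "t \<in> std_simplex" and j: "j \<in> {1..CARD('n) + 1}" and a: "0 < a j"
  shows "integrand c a t \<le> bary t j"
proof -
  have nn: "0 \<le> bary t l" "bary t l \<le> 1" if "l \<in> {1..CARD('n) + 1}" for l
    using t that bary_le_1 by (auto simp: mem_std_simplex_iff)
  have "(\<Prod>l\<in>{1..CARD('n) + 1} - {j}. bary t l ^ a l) \<le> 1"
    using nn by (intro prod_le_1) (auto simp: power_le_one)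
  moreover have "bary t j ^ a j \<le> bary t j ^ 1"
    using nn[OF j] a by (intro power_decreasing) auto
  moreover have "0 \<le> bary t j ^ a j"
    using nn[OF j] by simp
  ultimately show ?thesis
    unfolding integrand_remove[OF j] by (smt (verit) mult_left_le power_one_right)
qed

lemma move_vertex_in_std_simplex:
  assumes "i \<in> {1..CARD('n) + 1}" "x \<in> std_simplex" "s \<in> std_simplex"
  shows "move_vertex i x s \<in> std_simplex"
  using assms by (auto simp: mem_std_simplex_iff bary_move_vertex)

lemma sub_simplex_subset_std_simplex:
  assumes "i \<in> {1..CARD('n) + 1}" "x \<in> std_simplex"
  shows "sub_simplex c i x \<subseteq> std_simplex"
  using assms by (auto simp: move_vertex_image_std_simplex[symmetric] move_vertex_in_std_simplex)

lemma compact_sub_simplex: "compact (sub_simplex c i x)"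
  unfolding sub_simplex_def by (intro finite_imp_compact_convex_hull) simp

lemma integrable_integrand:
  assumes "compact S"
  shows "integrand c a integrable_on S"
  using continuous_on_integrand[of S "\<lambda>x. x"] assms
  by (intro absolutely_integrable_continuous_compact(3)) auto

text \<open>
  When \<open>x\<close> lies on the edge between the vertices \<open>i\<close> and \<open>j\<close>, the two sub-simplices meet along the hyperplane
  \<open>q t\<^sub>i = p t\<^sub>j\<close> through \<open>x\<close> and the other vertices, so this inequality decides on which side \<open>t\<close> lies.
\<close>
lemma mem_sub_simplex_edge:
  assumes i: "i \<in> {1..CARD('n) + 1}" and j: "j \<in> {1..CARD('n) + 1}" and "i \<noteq> j"
    and x: "bary x i = p" "bary x j = q" "\<And>l. l \<in> {1..CARD('n) + 1} - {i, j} \<Longrightarrow> bary x l = 0"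
    and p: "0 < p" "p + q = 1" and t: "t \<in> std_simplex" and le: "q * bary t i \<le> p * bary t j"
  shows "t \<in> sub_simplex c i x"
proof -
  define r where "r = bary t i / p"
  \<comment> \<open>the preimage of \<open>t\<close>: its \<open>i\<close>-th coordinate \<open>r\<close> satisfies \<open>r p = t\<^sub>i\<close>\<close>
  define s where "s = t + r *\<^sub>R (vertex c i - x)"
  have s: "bary s l = bary t l + r * ((if l = i then 1 else 0) - bary x l)"
    if "l \<in> {1..CARD('n) + 1}" for l
    unfolding s_def bary_add_scaleR_diff using that i by (auto simp: bary_vertex)
  have "bary s i = r"
  proof -
    have "bary s i = bary t i + r * (1 - p)"
      using s[OF i] x(1) by simp
    also have "\<dots> = r"
      using p by (simp add: r_def field_simps)
    finally show ?thesis .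
  qed
  then have "move_vertex i x s = t"
    by (simp add: move_vertex_def s_def algebra_simps)
  moreover have "s \<in> std_simplex"
    unfolding mem_std_simplex_iff
  proof
    fix l assume l: "l \<in> {1..CARD('n) + 1}"
    have t0: "0 \<le> bary t l" "0 \<le> bary t i"
      using t l i by (auto simp: mem_std_simplex_iff)
    consider "l = i" | "l = j" | "l \<in> {1..CARD('n) + 1} - {i, j}"
      using l by blast
    then show "0 \<le> bary s l"
    proof cases
      case 1
      then show ?thesis
        using \<open>bary s i = r\<close> t0 p by (simp add: r_def)
    next
      case 2
      then have "bary s l = bary t j - q * bary t i / p"
        using s[OF l] x(2) \<open>i \<noteq> j\<close> by (simp add: r_def)
      then show ?thesis
        using le p by (simp add: divide_le_eq mult.commute)
    next
      case 3
      then show ?thesis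
        using s[OF l] x(3)[OF 3] t0 by simp
    qed
  qed
  ultimately show ?thesis
    unfolding move_vertex_image_std_simplex[OF i, symmetric] by (metis imageI)
qed

lemma I_full_eq_sum_I_full_Suc:
  "I_full c a = (\<Sum>j\<in>{1..CARD('n) + 1}. I_full c (a(j := Suc (a j))))"
proof -
  have "(\<Sum>j\<in>{1..CARD('n) + 1}. I_full c (a(j := Suc (a j)))) =
      integral std_simplex (\<lambda>t. \<Sum>j\<in>{1..CARD('n) + 1}. integrand c (a(j := Suc (a j))) t)"
    unfolding I_full_def
    by (rule integral_sum[symmetric]) (auto intro: integrable_integrand compact_std_simplex)
  also have "(\<lambda>t. \<Sum>j\<in>{1..CARD('n) + 1}. integrand c (a(j := Suc (a j))) t) = integrand c a"
    by (rule ext) (simp only: integrand_upd_Suc sum_bary sum_distrib_right[symmetric] mult_1 cong: sum.cong)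
  finally show ?thesis
    by (simp only: I_full_def)
qed

text \<open>
  The simplex is cut by a point \<open>x h\<close> on the edge from vertex \<open>i\<close> to vertex \<open>j\<close>.  For the exponents
  \<open>b = a + e\<^sub>j\<close> the integral \<open>P h\<close> over the part that keeps vertex \<open>j\<close> is a polynomial in \<open>h\<close>, and what is
  lost against \<open>P 0\<close> is bounded by the integral over the other part, which is \<open>O(h\<^sup>2)\<close>.  The identity
  is the statement that the linear coefficient of \<open>P\<close> vanishes.
\<close>
lemma I_full_exchange:
  assumes i: "i \<in> {1..CARD('n) + 1}" and j: "j \<in> {1..CARD('n) + 1}"
  shows "real (Suc (a i)) * I_full c (a(j := Suc (a j))) = real (Suc (a j)) * I_full c (a(i := Suc (a i)))"
proof (cases "i = j")
  case False
  define q where "q = Suc (a j)"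
  define b where "b = a(j := q)"
  define W where "W = {1..CARD('n) + 1} - {i, j}"
  define rest where "rest = (\<lambda>s. \<Prod>l\<in>W. bary s l ^ a l)"
  \<comment> \<open>the moments that arise when \<open>(s\<^sub>j + h s\<^sub>i)\<close> to the power \<open>q\<close> is expanded; \<open>m 0\<close> and \<open>m 1\<close> are the integrals to be compared\<close>
  define m where "m = (\<lambda>k. integral std_simplex (\<lambda>s. rest s * bary s i ^ (a i + k) * bary s j ^ (q - k)))"
  define x where "x = (\<lambda>h::real. vertex c i + h *\<^sub>R (vertex c j - vertex c i))"
  have split: "integrand c e t = bary t i ^ e i * bary t j ^ e j * (\<Prod>l\<in>W. bary t l ^ e l)" for e t
  proof -
    have "{1..CARD('n) + 1} - {i} = insert j W"
      using j False by (auto simp: W_def)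
    then show ?thesis
      unfolding integrand_remove[OF i] by (simp add: W_def)
  qed
  have cont_rest: "continuous_on UNIV rest"
    unfolding rest_def by (intro continuous_intros)
  have cont: "continuous_on UNIV (\<lambda>s. rest s * bary s i ^ k * bary s j ^ l)" for k l
    by (intro continuous_intros cont_rest)
  have m0: "m 0 = I_full c b"
  proof -
    have "integrand c b = (\<lambda>s. rest s * bary s i ^ (a i + 0) * bary s j ^ (q - 0))"
      using False by (intro ext) (simp add: split b_def rest_def W_def)
    then show ?thesis
      by (simp add: m_def I_full_def)
  qed
  have m1: "m 1 = I_full c (a(i := Suc (a i)))"
  proof -
    have "integrand c (a(i := Suc (a i))) = (\<lambda>s. rest s * bary s i ^ (a i + 1) * bary s j ^ (q - 1))"
      using False by (intro ext) (simp add: split q_def rest_def W_def)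
    then show ?thesis
      by (simp add: m_def I_full_def)
  qed
  have bx: "bary (x h) l = (if l = i then 1 - h else if l = j then h else 0)"
    if "l \<in> {1..CARD('n) + 1}" for l h
    unfolding x_def bary_add_scaleR_diff using that i j False by (auto simp: bary_vertex)
  have bxi: "bary (x h) i = 1 - h" and bxj: "bary (x h) j = h" for h
    using bx[OF i] bx[OF j] False by simp_all
  have bx0: "bary (x h) l = 0" if "l \<in> {1..CARD('n) + 1} - {i, j}" for h l
    using bx[of l h] that by simp
  define P where "P = (\<lambda>h. (1 - h) ^ Suc (a i) * (\<Sum>k\<le>q. real (q choose k) * m k * h ^ k))"
  have I_sub_P: "I_sub c i b (x h) = P h" if h: "0 < h" "h < 1" for h
  proof -
    have "integrand c b (move_vertex i (x h) s) =
        (\<Sum>k\<le>q. ((1 - h) ^ a i * real (q choose k) * h ^ k) *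
                (rest s * bary s i ^ (a i + k) * bary s j ^ (q - k)))" for s
    proof -
      have "(\<Prod>l\<in>W. bary (move_vertex i (x h) s) l ^ b l) = rest s"
        unfolding rest_def using i by (intro prod.cong refl) (auto simp: W_def bary_move_vertex bx b_def)
      then have "integrand c b (move_vertex i (x h) s) =
          (bary s i * (1 - h)) ^ a i * (bary s i * h + bary s j) ^ q * rest s"
        using False i j unfolding split by (simp add: bary_move_vertex bx b_def add.commute)
      also have "\<dots> = (\<Sum>k\<le>q. (bary s i * (1 - h)) ^ a i *
          (real (q choose k) * (bary s i * h) ^ k * bary s j ^ (q - k)) * rest s)"
        by (simp only: binomial_ring sum_distrib_left sum_distrib_right)
      also have "\<dots> = (\<Sum>k\<le>q. ((1 - h) ^ a i * real (q choose k) * h ^ k) *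
                (rest s * bary s i ^ (a i + k) * bary s j ^ (q - k)))"
        by (intro sum.cong refl) (simp add: power_mult_distrib power_add)
      finally show ?thesis .
    qed
    then have "I_sub c i b (x h) = (1 - h) * integral std_simplex (\<lambda>s. \<Sum>k\<le>q.
        ((1 - h) ^ a i * real (q choose k) * h ^ k) * (rest s * bary s i ^ (a i + k) * bary s j ^ (q - k)))"
      unfolding I_sub_def using h i
      by (subst integral_sub_simplex[OF i]) (auto intro!: continuous_intros simp: bx)
    also have "\<dots> = (1 - h) * (\<Sum>k\<le>q. ((1 - h) ^ a i * real (q choose k) * h ^ k) * m k)"
      unfolding m_def
      by (subst integral_sum) (auto intro!: integrable_std_simplex continuous_intros cont_rest)
    also have "\<dots> = P h"
      by (simp add: P_def sum_distrib_left algebra_simps)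
    finally show ?thesis .
  qed
  define C where "C = integral std_simplex (\<lambda>_::real^'n. 1::real)"
  have bound: "\<bar>P h - P 0\<bar> \<le> C * h\<^sup>2" if h: "0 < h" "h < 1" for h
  proof -
    have xin: "x h \<in> std_simplex"
      using h by (auto simp: mem_std_simplex_iff bx)
    have subi: "sub_simplex c i (x h) \<subseteq> std_simplex" and subj: "sub_simplex c j (x h) \<subseteq> std_simplex"
      using sub_simplex_subset_std_simplex i j xin by auto
    have cover: "t \<in> sub_simplex c i (x h) \<union> sub_simplex c j (x h)" if t: "t \<in> std_simplex" for t
    proof (cases "h * bary t i \<le> (1 - h) * bary t j")
      case True
      then have "t \<in> sub_simplex c i (x h)"
        using h by (intro mem_sub_simplex_edge[OF i j False bxi bxj bx0]) (auto simp: t)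
      then show ?thesis
        by simp
    next
      case ge: False
      then have "t \<in> sub_simplex c j (x h)"
        using h False bx0
        by (intro mem_sub_simplex_edge[OF j i _ bxj bxi]) (auto simp: t insert_commute)
      then show ?thesis
        by simp
    qed
    have "I_sub c i b (x h) \<le> I_full c b"
      unfolding I_sub_def I_full_def
      by (intro integral_subset_le subi integrable_integrand compact_sub_simplex compact_std_simplex)
         (simp add: integrand_nonneg)
    moreover have "I_full c b \<le> I_sub c i b (x h) + I_sub c j b (x h)"
    proof -
      \<comment> \<open>extension by zero, so that the overlap of the two parts needs no separate treatment\<close>
      define F where "F = (\<lambda>A t. if t \<in> A then integrand c b t else 0)"
      have int: "F A integrable_on UNIV" if "compact A" for A
        using integrable_integrand[OF that] unfolding F_def by (simp only: integrable_restrict_UNIV)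
      have "I_full c b = integral UNIV (F std_simplex)"
        unfolding F_def I_full_def by (simp only: integral_restrict_UNIV)
      also have "\<dots> \<le> integral UNIV (\<lambda>t. F (sub_simplex c i (x h)) t + F (sub_simplex c j (x h)) t)"
      proof (rule integral_le)
        show "F std_simplex t \<le> F (sub_simplex c i (x h)) t + F (sub_simplex c j (x h)) t" for t
          using cover[of t] subi subj integrand_nonneg[of t b] by (auto simp: F_def)
      qed (intro int integrable_add compact_std_simplex compact_sub_simplex)+
      also have "\<dots> = integral UNIV (F (sub_simplex c i (x h))) + integral UNIV (F (sub_simplex c j (x h)))"
        by (intro integral_add int compact_sub_simplex)
      also have "\<dots> = I_sub c i b (x h) + I_sub c j b (x h)"
        unfolding F_def I_sub_def by (simp only: integral_restrict_UNIV)
      finally show ?thesis .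
    qed
    \<comment> \<open>one factor \<open>h\<close> is the determinant, the other bounds the coordinate \<open>j\<close> on the small part\<close>
    moreover have "I_sub c j b (x h) \<le> C * h\<^sup>2"
    proof -
      have "I_sub c j b (x h) = h * integral std_simplex (\<lambda>s. integrand c b (move_vertex j (x h) s))"
        unfolding I_sub_def using h j False
        by (subst integral_sub_simplex[OF j]) (auto intro!: continuous_intros simp: bx)
      also have "integral std_simplex (\<lambda>s. integrand c b (move_vertex j (x h) s)) \<le>
          integral std_simplex (\<lambda>_::real^'n. h)"
      proof (rule integral_le)
        fix s :: "real^'n" assume s: "s \<in> std_simplex"
        have "integrand c b (move_vertex j (x h) s) \<le> bary (move_vertex j (x h) s) j"
          using move_vertex_in_std_simplex[OF j xin s] j by (rule integrand_le_bary) (simp add: b_def q_def)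
        also have "\<dots> = bary s j * h"
          using j False by (simp add: bary_move_vertex bx)
        also have "\<dots> \<le> 1 * h"
          using bary_le_1[OF s j] h by (intro mult_right_mono) auto
        finally show "integrand c b (move_vertex j (x h) s) \<le> h"
          by simp
      qed (auto intro!: integrable_std_simplex continuous_intros)
      also have "integral std_simplex (\<lambda>_::real^'n. h) = C * h"
        unfolding C_def by (subst integral_mult_left[symmetric]) auto
      finally show ?thesis
        using h by (simp add: power2_eq_square algebra_simps)
    qed
    moreover have "P 0 = I_full c b"
    proof -
      have "(\<Sum>k\<le>q. real (q choose k) * m k * 0 ^ k) = (\<Sum>k\<le>q. if k = 0 then m 0 else 0)"
        by (intro sum.cong) auto
      then show ?thesis
        by (simp add: P_def m0)
    qed
    ultimately show ?thesis
      using I_sub_P[OF h] by simp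
  qed
  have "(P has_real_derivative (- real (Suc (a i)) * m 0 + real q * m 1)) (at 0)"
  proof -
    have S: "((\<lambda>h. \<Sum>k\<le>q. real (q choose k) * m k * h ^ k) has_real_derivative
        (\<Sum>k\<le>q. real (q choose k) * m k * (real k * 0 ^ (k - 1)))) (at 0)"
      by (intro DERIV_sum) (auto intro!: derivative_eq_intros)
    have "(\<Sum>k\<le>q. real (q choose k) * m k * (real k * 0 ^ (k - 1))) =
        (\<Sum>k\<le>q. if k = 1 then real q * m 1 else 0)"
      by (intro sum.cong) (auto simp: power_0_left)
    also have "\<dots> = real q * m 1"
      by (simp add: q_def)
    finally have S': "((\<lambda>h. \<Sum>k\<le>q. real (q choose k) * m k * h ^ k) has_real_derivative
        real q * m 1) (at 0)"
      using S by simp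
    have "(\<Sum>k\<le>q. real (q choose k) * m k * 0 ^ k) = (\<Sum>k\<le>q. if k = 0 then m 0 else 0)"
      by (intro sum.cong) auto
    then have S0: "(\<Sum>k\<le>q. real (q choose k) * m k * 0 ^ k) = m 0"
      by simp
    show ?thesis
      unfolding P_def
      by (rule derivative_eq_intros S' refl)+ (simp add: S0)
  qed
  then have "- real (Suc (a i)) * m 0 + real q * m 1 = 0"
    using bound by (rule derivative_zero_of_quadratic_bound)
  then show ?thesis
    unfolding m0 m1 b_def q_def by (simp add: algebra_simps)
qed simp

text \<open>
  Since the barycentric coordinates sum to one, \<open>I\<^sub>a\<close> is the sum over \<open>j\<close> of the integrals with \<open>a\<^sub>j\<close> raised
  by one, and the exchange identity expresses each of these by the one with \<open>a\<^sub>i\<close> raised.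
\<close>
lemma I_full_Suc:
  assumes i: "i \<in> {1..CARD('n) + 1}"
  shows "real (Suc (CARD('n) + sum a {1..CARD('n) + 1})) * I_full c (a(i := Suc (a i))) =
         real (Suc (a i)) * I_full c a"
proof -
  have "real (Suc (a i)) * I_full c a =
      (\<Sum>j\<in>{1..CARD('n) + 1}. real (Suc (a i)) * I_full c (a(j := Suc (a j))))"
    by (subst I_full_eq_sum_I_full_Suc) (rule sum_distrib_left)
  also have "\<dots> = (\<Sum>j\<in>{1..CARD('n) + 1}. real (Suc (a j)) * I_full c (a(i := Suc (a i))))"
    by (rule sum.cong[OF refl]) (rule I_full_exchange[OF i])
  also have "\<dots> = (\<Sum>j\<in>{1..CARD('n) + 1}. real (Suc (a j))) * I_full c (a(i := Suc (a i)))"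
    by (rule sum_distrib_right[symmetric])
  also have "(\<Sum>j\<in>{1..CARD('n) + 1}. real (Suc (a j))) = real (Suc (CARD('n) + sum a {1..CARD('n) + 1}))"
    unfolding of_nat_sum[symmetric] by (simp only: Suc_eq_plus1 sum.distrib) simp
  finally show ?thesis
    by (rule sym)
qed

text \<open>
  Induction on the total degree: every exponent vector of positive degree is some \<open>e\<close> with one entry raised, and
  degree \<open>0\<close> is the volume \<open>1 / n!\<close> of the simplex.
\<close>
theorem dirichlet_integral:
  "I_full c a = (\<Prod>j\<in>{1..CARD('n) + 1}. fact (a j)) / fact (CARD('n) + sum a {1..CARD('n) + 1})"
proof (induction "sum a {1..CARD('n) + 1}" arbitrary: a)
  case 0
  have a0: "a j = 0" if "j \<in> {1..CARD('n) + 1}" for j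
  proof -
    have "a j \<le> sum a {1..CARD('n) + 1}"
      by (rule member_le_sum) (use that in auto)
    with 0 show ?thesis
      by linarith
  qed
  have "integrand c a = (\<lambda>_. 1)"
    unfolding integrand_def using a0 by (intro ext prod.neutral) auto
  then have "I_full c a = measure lebesgue (std_simplex :: (real^'n) set)"
    by (simp only: I_full_def lmeasure_integral[OF lmeasurable_compact[OF compact_std_simplex]])
  also have "\<dots> = measure lborel (std_simplex :: (real^'n) set)"
    by (rule measure_completion) (simp add: borel_compact compact_std_simplex)
  also have "\<dots> = 1 / fact (CARD('n))"
    unfolding std_simplex_def by (subst content_std_simplex) simp
  finally show ?case
    using 0 a0 by simp
next
  case (Suc m)
  then have "sum a {1..CARD('n) + 1} \<noteq> 0"
    by linarith
  then obtain i where i: "i \<in> {1..CARD('n) + 1}" "a i \<noteq> 0"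
    by (rule sum.not_neutral_contains_not_neutral)
  define e where "e = a(i := a i - 1)"
  have a_i: "a i = Suc (e i)" and a_e: "a = e(i := Suc (e i))"
    using i(2) by (simp_all add: e_def)
  have a_j: "a j = e j" if "j \<in> {1..CARD('n) + 1} - {i}" for j
    using that by (simp add: e_def)
  have sum_a: "sum a {1..CARD('n) + 1} = Suc (sum e {1..CARD('n) + 1})"
  proof -
    have "sum f {1..CARD('n) + 1} = f i + sum f ({1..CARD('n) + 1} - {i})" for f :: "nat \<Rightarrow> nat"
      by (rule sum.remove[OF finite_atLeastAtMost i(1)])
    moreover have "sum a ({1..CARD('n) + 1} - {i}) = sum e ({1..CARD('n) + 1} - {i})"
      by (rule sum.cong[OF refl a_j])
    ultimately show ?thesis
      by (simp only: a_i add_Suc)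
  qed
  then have m: "m = sum e {1..CARD('n) + 1}"
    using Suc.hyps(2) by linarith
  have "(\<Prod>j\<in>{1..CARD('n) + 1}. fact (a j) :: real) =
      fact (a i) * (\<Prod>j\<in>{1..CARD('n) + 1} - {i}. fact (a j))"
    by (rule prod_remove_index[OF i(1)])
  also have "(\<Prod>j\<in>{1..CARD('n) + 1} - {i}. fact (a j) :: real) =
      (\<Prod>j\<in>{1..CARD('n) + 1} - {i}. fact (e j))"
    by (intro prod.cong refl) (simp only: a_j)
  also have "fact (a i) * \<dots> = real (Suc (e i)) * (fact (e i) * \<dots>)"
    by (simp only: a_i fact_Suc mult.assoc)
  also have "fact (e i) * (\<Prod>j\<in>{1..CARD('n) + 1} - {i}. fact (e j) :: real) =
      (\<Prod>j\<in>{1..CARD('n) + 1}. fact (e j))"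
    by (rule prod_remove_index[OF i(1), symmetric])
  finally have prod_a: "(\<Prod>j\<in>{1..CARD('n) + 1}. fact (a j) :: real) =
      real (Suc (e i)) * (\<Prod>j\<in>{1..CARD('n) + 1}. fact (e j))" .
  have "real (Suc (CARD('n) + m)) * I_full c a = real (Suc (e i)) * I_full c e"
    using I_full_Suc[OF i(1), of e] by (simp only: a_e[symmetric] m)
  also have "I_full c e = (\<Prod>j\<in>{1..CARD('n) + 1}. fact (e j)) / fact (CARD('n) + m)"
    using Suc.hyps(1)[OF m] by (simp only: m)
  finally show ?case
    unfolding sum_a prod_a m[symmetric] by (simp add: field_simps del: of_nat_Suc)
qed

section \<open>Integrals over the sub-simplices\<close>

text \<open>
  Dirichlet's formula with index \<open>i\<close> singled out and the others enumerated by \<open>\<tau>\<close>, which is the form in which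
  the monomials of the binomial expansion appear.
\<close>
lemma integral_monomial_reindexed:
  assumes i: "i \<in> {1..CARD('n) + 1}" and \<tau>: "bij_betw \<tau> {1..CARD('n)} ({1..CARD('n) + 1} - {i})"
  shows "integral std_simplex (\<lambda>s. bary s i ^ p * (\<Prod>j = 1..CARD('n). bary s (\<tau> j) ^ q j)) =
         fact p * (\<Prod>j = 1..CARD('n). fact (q j)) / fact (CARD('n) + (p + (\<Sum>j = 1..CARD('n). q j)))"
proof -
  define b where "b = (\<lambda>l. if l = i then p else q (inv_into {1..CARD('n)} \<tau> l))"
  have b_i: "b i = p"
    by (simp add: b_def)
  have b_\<tau>: "b (\<tau> j) = q j" if "j \<in> {1..CARD('n)}" for j
    using bij_betwE[OF \<tau>] bij_betw_inv_into_left[OF \<tau> that] that by (auto simp: b_def)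
  have reindex: "(\<Prod>l\<in>{1..CARD('n) + 1}. g l (b l)) = g i p * (\<Prod>j = 1..CARD('n). g (\<tau> j) (q j))"
    for g :: "nat \<Rightarrow> nat \<Rightarrow> real"
  proof -
    have "(\<Prod>l\<in>{1..CARD('n) + 1} - {i}. g l (b l)) = (\<Prod>j = 1..CARD('n). g (\<tau> j) (b (\<tau> j)))"
      by (rule prod.reindex_bij_betw[OF \<tau>, symmetric])
    also have "\<dots> = (\<Prod>j = 1..CARD('n). g (\<tau> j) (q j))"
      by (rule prod.cong[OF refl]) (simp only: b_\<tau>)
    finally show ?thesis
      by (simp only: prod_remove_index[OF i] b_i)
  qed
  have "sum b {1..CARD('n) + 1} = b i + sum b ({1..CARD('n) + 1} - {i})"
    by (rule sum.remove[OF finite_atLeastAtMost i])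
  also have "sum b ({1..CARD('n) + 1} - {i}) = (\<Sum>j = 1..CARD('n). b (\<tau> j))"
    by (rule sum.reindex_bij_betw[OF \<tau>, symmetric])
  also have "\<dots> = (\<Sum>j = 1..CARD('n). q j)"
    by (rule sum.cong[OF refl b_\<tau>])
  finally have sum_b: "sum b {1..CARD('n) + 1} = p + (\<Sum>j = 1..CARD('n). q j)"
    by (simp only: b_i)
  have "integrand c b = (\<lambda>s. bary s i ^ p * (\<Prod>j = 1..CARD('n). bary s (\<tau> j) ^ q j))"
    unfolding integrand_def by (rule ext) (rule reindex)
  then have "integral std_simplex (\<lambda>s. bary s i ^ p * (\<Prod>j = 1..CARD('n). bary s (\<tau> j) ^ q j)) = I_full c b"
    by (simp only: I_full_def)
  also have "\<dots> = fact p * (\<Prod>j = 1..CARD('n). fact (q j)) / fact (CARD('n) + (p + (\<Sum>j = 1..CARD('n). q j)))"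
    by (simp only: dirichlet_integral sum_b reindex[of "\<lambda>_. fact"])
  finally show ?thesis .
qed

text \<open>
  For a multi-index \<open>k\<close>, the binomial coefficients contribute \<open>b\<^sub>j! / (k\<^sub>j! (b\<^sub>j - k\<^sub>j)!)\<close>, and Dirichlet's formula
  replaces \<open>a\<^sub>i! b\<^sub>j!\<close> by \<open>(a\<^sub>i + \<Sum>\<^sub>j k\<^sub>j)! (b\<^sub>j - k\<^sub>j)!\<close> over an unchanged denominator.  What is left is
  \<open>(a\<^sub>i + \<Sum>\<^sub>j k\<^sub>j)! / a\<^sub>i!\<close>, a Pochhammer symbol, over the \<open>k\<^sub>j!\<close>.  Any enumeration \<open>\<tau>\<close> of the indices
  other than \<open>i\<close> will do.
\<close>
theorem I_sub_div_I_full: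
  assumes i: "i \<in> {1..CARD('n) + 1}" and \<tau>: "bij_betw \<tau> {1..CARD('n)} ({1..CARD('n) + 1} - {i})"
    and x: "x \<in> std_simplex"
    and b: "\<And>j. j \<in> {1..CARD('n)} \<Longrightarrow> b j = a (\<tau> j)" "b (CARD('n) + 1) = a i"
    and y: "\<And>j. j \<in> {1..CARD('n)} \<Longrightarrow> y j = bary x (\<tau> j)"
  shows "I_sub c i a x / I_full c a = f_poly CARD('n) b y"
proof -
  define N where "N = CARD('n)"
  define p where "p = a i"
  define z where "z = bary x i"
  define K where "K = (\<Pi>\<^sub>E j\<in>{1..N}. {0..b j})"
  define A where "A = N + (p + (\<Sum>j = 1..N. b j))"
  have z0: "0 \<le> z"
    using x i by (auto simp: z_def mem_std_simplex_iff)
  have \<tau>V: "\<tau> j \<in> {1..CARD('n) + 1}" "\<tau> j \<noteq> i" if "j \<in> {1..N}" for j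
    using bij_betwE[OF \<tau>] that by (auto simp: N_def)
  have K: "k j \<le> b j" if "k \<in> K" "j \<in> {1..N}" for k j
    using that by (auto simp: K_def PiE_iff)
  have finK: "finite K"
    unfolding K_def by (intro finite_PiE) auto
  have prod_V: "(\<Prod>l\<in>{1..CARD('n) + 1} - {i}. g l) = (\<Prod>j = 1..N. g (\<tau> j))" for g :: "nat \<Rightarrow> real"
    unfolding N_def by (rule prod.reindex_bij_betw[OF \<tau>, symmetric])
  have z: "1 - (\<Sum>j = 1..N. y j) = z"
  proof -
    have "1 = z + sum (bary x) ({1..CARD('n) + 1} - {i})"
      unfolding z_def sum_bary[of x, symmetric] by (rule sum.remove[OF finite_atLeastAtMost i])
    also have "sum (bary x) ({1..CARD('n) + 1} - {i}) = (\<Sum>j = 1..N. bary x (\<tau> j))"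
      unfolding N_def by (rule sum.reindex_bij_betw[OF \<tau>, symmetric])
    also have "\<dots> = (\<Sum>j = 1..N. y j)"
      by (rule sum.cong[OF refl]) (simp only: y N_def)
    finally show ?thesis
      by simp
  qed
  have full: "I_full c a = fact p * (\<Prod>j = 1..N. fact (b j)) / fact A"
  proof -
    have "integrand c a = (\<lambda>s. bary s i ^ p * (\<Prod>j = 1..N. bary s (\<tau> j) ^ b j))"
      unfolding integrand_remove[OF i] prod_V p_def
      by (intro ext arg_cong2[where f = "(*)"] prod.cong refl) (simp only: b N_def)
    then show ?thesis
      using integral_monomial_reindexed[OF i \<tau>, of p b]
      by (simp only: I_full_def A_def N_def)
  qed
  define coeff where "coeff = (\<lambda>k. \<Prod>j = 1..N. real (b j choose k j) * y j ^ k j)"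
  define mon where "mon = (\<lambda>k s. bary s i ^ (p + (\<Sum>j = 1..N. k j)) * (\<Prod>j = 1..N. bary s (\<tau> j) ^ (b j - k j)))"
  have expand: "integrand c a (move_vertex i x s) = z ^ p * (\<Sum>k\<in>K. coeff k * mon k s)" for s
  proof -
    have "(\<Prod>l\<in>{1..CARD('n) + 1} - {i}. bary (move_vertex i x s) l ^ a l) =
        (\<Prod>j = 1..N. (bary s i * y j + bary s (\<tau> j)) ^ b j)"
      unfolding prod_V
    proof (rule prod.cong[OF refl])
      fix j assume j: "j \<in> {1..N}"
      have "bary (move_vertex i x s) (\<tau> j) = bary s i * y j + bary s (\<tau> j)"
        using bary_move_vertex[OF i \<tau>V(1)[OF j], of x s] \<tau>V(2)[OF j] y j by (simp add: N_def)
      then show "bary (move_vertex i x s) (\<tau> j) ^ a (\<tau> j) = (bary s i * y j + bary s (\<tau> j)) ^ b j"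
        using b(1) j by (simp add: N_def)
    qed
    also have "\<dots> = (\<Prod>j = 1..N. \<Sum>k = 0..b j.
        real (b j choose k) * (bary s i * y j) ^ k * bary s (\<tau> j) ^ (b j - k))"
      by (simp only: binomial_ring atLeast0AtMost)
    also have "\<dots> = (\<Sum>k\<in>K. \<Prod>j = 1..N.
        real (b j choose k j) * (bary s i * y j) ^ k j * bary s (\<tau> j) ^ (b j - k j))"
      unfolding K_def by (rule prod_sum_PiE) auto
    also have "\<dots> = (\<Sum>k\<in>K. coeff k * (bary s i ^ (\<Sum>j = 1..N. k j) * (\<Prod>j = 1..N. bary s (\<tau> j) ^ (b j - k j))))"
      by (intro sum.cong refl)
         (simp add: coeff_def power_mult_distrib prod.distrib power_sum mult_ac)
    finally have "(\<Prod>l\<in>{1..CARD('n) + 1} - {i}. bary (move_vertex i x s) l ^ a l) = \<dots>" .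
    moreover have "bary (move_vertex i x s) i = bary s i * z"
      using bary_move_vertex[OF i i] by (simp add: z_def)
    ultimately have expanded: "integrand c a (move_vertex i x s) = (bary s i * z) ^ p *
        (\<Sum>k\<in>K. coeff k * (bary s i ^ (\<Sum>j = 1..N. k j) * (\<Prod>j = 1..N. bary s (\<tau> j) ^ (b j - k j))))"
      unfolding integrand_remove[OF i] p_def by simp
    then show ?thesis
      by (simp add: mon_def power_mult_distrib power_add sum_distrib_left mult_ac)
  qed
  have int_mon: "integral std_simplex (mon k) =
      fact (p + (\<Sum>j = 1..N. k j)) * (\<Prod>j = 1..N. fact (b j - k j)) / fact A" if k: "k \<in> K" for k
  proof -
    have "(\<Sum>j = 1..N. k j) + (\<Sum>j = 1..N. b j - k j) = (\<Sum>j = 1..N. b j)"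
      unfolding sum.distrib[symmetric] by (intro sum.cong refl) (use K[OF k] in auto)
    then have "N + (p + (\<Sum>j = 1..N. k j) + (\<Sum>j = 1..N. b j - k j)) = A"
      by (simp add: A_def)
    then show ?thesis
      using integral_monomial_reindexed[OF i \<tau>, of "p + (\<Sum>j = 1..N. k j)" "\<lambda>j. b j - k j"]
      by (simp only: mon_def N_def[symmetric])
  qed
  have "I_sub c i a x = z * integral std_simplex (\<lambda>s. z ^ p * (\<Sum>k\<in>K. coeff k * mon k s))"
    unfolding I_sub_def using z0
    by (subst integral_sub_simplex[OF i]) (auto intro!: continuous_intros simp: expand z_def)
  also have "\<dots> = z ^ (p + 1) * integral std_simplex (\<lambda>s. \<Sum>k\<in>K. coeff k * mon k s)"
    by (simp only: integral_mult_right power_add power_one_right mult_ac)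
  also have "integral std_simplex (\<lambda>s. \<Sum>k\<in>K. coeff k * mon k s) =
      (\<Sum>k\<in>K. coeff k * integral std_simplex (mon k))"
    by (subst integral_sum[OF finK])
       (auto intro!: integrable_std_simplex continuous_intros simp: mon_def)
  finally have sub: "I_sub c i a x = z ^ (p + 1) * (\<Sum>k\<in>K. coeff k * integral std_simplex (mon k))" .
  \<comment> \<open>the common denominator \<open>fact A\<close> cancels: lowering each \<open>b j\<close> by \<open>k j\<close> and raising \<open>p\<close> by their sum keeps the degree\<close>
  have ratio: "coeff k * integral std_simplex (mon k) / I_full c a =
      pochhammer (real (p + 1)) (\<Sum>j = 1..N. k j) / (\<Prod>j = 1..N. fact (k j)) * (\<Prod>j = 1..N. y j ^ k j)"
    if k: "k \<in> K" for k
  proof -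
    define S where "S = (\<Sum>j = 1..N. k j)"
    have "coeff k = (\<Prod>j = 1..N. fact (b j) / (fact (k j) * fact (b j - k j)) * y j ^ k j)"
      unfolding coeff_def by (intro prod.cong refl) (simp add: binomial_fact K[OF k])
    also have "\<dots> = (\<Prod>j = 1..N. fact (b j)) /
        ((\<Prod>j = 1..N. fact (k j)) * (\<Prod>j = 1..N. fact (b j - k j))) * (\<Prod>j = 1..N. y j ^ k j)"
      by (simp only: prod.distrib prod_dividef)
    finally have coeff_k: "coeff k = \<dots>" .
    have poch: "fact (p + S) = fact p * pochhammer (real (p + 1)) S"
      using pochhammer_product'[of "1::real" p S] by (simp add: pochhammer_fact add.commute)
    have nz: "(\<Prod>j = 1..N. fact (b j) :: real) \<noteq> 0" "(\<Prod>j = 1..N. fact (b j - k j) :: real) \<noteq> 0"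
      by simp_all
    show ?thesis
      unfolding int_mon[OF k] full coeff_k S_def[symmetric] poch
      using nz by (simp add: field_simps)
  qed
  have "I_sub c i a x / I_full c a = z ^ (p + 1) * (\<Sum>k\<in>K. coeff k * integral std_simplex (mon k) / I_full c a)"
    unfolding sub by (simp only: sum_divide_distrib[symmetric] times_divide_eq_right)
  also have "\<dots> = z ^ (p + 1) * (\<Sum>k\<in>K. pochhammer (real (p + 1)) (\<Sum>j = 1..N. k j) /
      (\<Prod>j = 1..N. fact (k j)) * (\<Prod>j = 1..N. y j ^ k j))"
    using ratio by (simp only: cong: sum.cong)
  also have "\<dots> = f_poly N b y"
    using b(2) by (simp only: f_poly_def z[unfolded N_def] K_def N_def p_def)
  finally show ?thesis
    by (simp only: N_def)
qed

end

theorem theorem12p2: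
  fixes c :: "nat \<Rightarrow> 'n::finite" and a :: "nat \<Rightarrow> nat" and x :: "real ^ 'n"
    and n i m :: nat and \<sigma> :: "nat \<Rightarrow> nat"
  assumes "n = CARD('n)"
    and "bij_betw c {1..n} UNIV"
    and "x \<in> std_simplex"
    and "i \<in> {1..n + 1}"
    and "\<sigma> = cycle_of_list [1..<n + 2] ^^ m"
    and "\<sigma> n = i"
  shows "I_sub c i a x / I_full c a =
         f_poly n (\<lambda>j. if j = 1 then a (\<sigma> (n + 1)) else a (\<sigma> (j - 1)))
                  (\<lambda>j. if j = 1 then coord c x (\<sigma> (n + 1)) else coord c x (\<sigma> (j - 1)))"
proof -
  interpret coordinate_numbering c
    using assms(1,2) by unfold_locales simp
  \<comment> \<open>the shift by which the arguments of \<open>f\<close> are listed: \<open>\<sigma> \<circ> \<rho>\<close> runs through \<open>\<sigma>(n + 1), \<sigma> 1, \<dots>, \<sigma>(n - 1)\<close>, omitting \<open>\<sigma> n = i\<close>\<close>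
  define \<rho> where "\<rho> = (\<lambda>j::nat. if j = 1 then n + 1 else j - 1)"
  have n: "n \<ge> 1"
    using assms(1) by (simp add: Suc_leI)
  have set_upt_eq: "set [1..<n + 2] = {1..n + 1}"
    by auto
  have cycle: "cycle_of_list [1..<n + 2] permutes {1..n + 1}"
    using cycle_permutes[of "[1..<n + 2]"] by (simp only: set_upt_eq)
  have \<sigma>: "\<sigma> permutes {1..n + 1}"
    unfolding assms(5)
  proof (induction m)
    case 0
    show ?case
      by (simp only: funpow.simps permutes_id)
  next
    case (Suc m)
    then show ?case
      using permutes_compose[OF _ cycle] by (simp only: funpow.simps)
  qed
  have "bij_betw \<rho> {1..n} ({1..n + 1} - {n})"
    by (rule bij_betw_byWitness[where f' = "\<lambda>l. if l = n + 1 then 1 else l + 1"])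
       (use n in \<open>auto simp: \<rho>_def\<close>)
  moreover have "bij_betw \<sigma> ({1..n + 1} - {n}) ({1..n + 1} - {i})"
  proof -
    have "\<sigma> ` ({1..n + 1} - {n}) = {1..n + 1} - {i}"
      using image_set_diff[OF permutes_inj[OF \<sigma>], of "{1..n + 1}" "{n}"]
      by (simp only: permutes_image[OF \<sigma>] assms(6) image_insert image_empty)
    then show ?thesis
      using permutes_inj_on[OF \<sigma>] by (simp only: bij_betw_def)
  qed
  ultimately have \<tau>: "bij_betw (\<sigma> \<circ> \<rho>) {1..n} ({1..n + 1} - {i})"
    by (rule bij_betw_trans)
  show ?thesis
    unfolding assms(1)
    by (rule I_sub_div_I_full[where \<tau> = "\<sigma> \<circ> \<rho>"])
       (use assms \<tau> n in \<open>auto simp: \<rho>_def\<close>)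
qed

end
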